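(* Let $f:\mathbb{R}^d\to\mathbb{R}$, $g:\mathbb{R}^d\to\mathbb{R}^n$, $h:\mathbb{R}^d\to\mathbb{R}^m$ be functions, $\Omega\subseteq\mathbb{R}^d$ a closed subset, and, for $i=1,\dots,s$, let $\phi_i:\mathbb{R}\to\mathbb{R}$ be lower semi-continuous and $\omega_i:\mathbb{R}^d\to\mathbb{R}$ continuous. Let $x^*$ be a local minimizer of $$\min\ f(x)+\Phi(x)\quad\text{s.t.}\quad g(x)\le0,\ h(x)=0,\qquad\text{where}\quad \Phi(x):=\sum_{i=1}^s\phi_i(\omega_i(x))+\delta_\Omega(x),$$ with $x^*\in\Omega$, and suppose $f,g,h$ are Lipschitz around $x^*$. Let $t^*:=\omega(x^* )=(\omega_1(x^* ),\dots,\omega_s(x^* ))$, $\mathcal I:=\{i:\partial^\infty\phi_i(t_i^* )=\{0\}\}$, and let $\mathcal I^c$ be the complement of $\mathcal I$ in $\{1,\dots,s\}$. Assume that $\hat\partial\phi_i(t_i^* )=\mathbb{R}$ for every $i\in\mathcal I^c$ and that the following restricted system in $(x,t)\in\mathbb{R}^d\times\mathbb{R}^s$, $$g(x)\le0,\quad h(x)=0,\quad x\in\Omega,\quad \omega_i(x)-t_i=0\ (i=1,\dots,s),\quad t_i-t_i^*=0\ (i\in\mathcal I^c),$$ admits a local error bound at $(x^*,t^* )$. Then there exists $\rho_0>0$ such that for any $\rho\ge\rho_0$, $x^*$ is also a local minimizer of the exact penalization problem $$\min_{x\in\Omega}\ f(x)+\sum_{i=1}^s\phi_i(\omega_i(x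))+\rho\,\bigl(\|g(x)_+\|+\|h(x)\|\bigr).$$
   Context: $\delta_\Omega$ is the indicator function ($0$ on $\Omega$, $+\infty$ off $\Omega$); $\|\cdot\|$ is any norm on the relevant finite-dimensional space; $y_+$ is the componentwise non-negative part; $\mathrm{dist}$ is Euclidean distance; $\mathcal B_\delta$ denotes a closed ball of radius $\delta$. For $\varphi$ finite at $\bar x$: the regular subdifferential is $\hat\partial\varphi(\bar x)=\{v:\varphi(x)\ge\varphi(\bar x)+v^T(x-\bar x)+o(\|x-\bar x\|)\ \forall x\}$; the horizon subdifferential is $\partial^\infty\varphi(\bar x)=\{v:\exists x^k\to\bar x,\ \varphi(x^k)\to\varphi(\bar x),\ v^k\in\hat\partial\varphi(x^k),\ t_k\ge0,\ t_k\to0,\ t_kv^k\to v\}$. Local error bound: let $\mathcal F'$ be the solution set of the restricted system. The system admits a local error bound at $(x^*,t^* )$ if there exist $\delta>0$ and $\kappa>0$ such that for all $(x,t)\in\mathcal B_\delta(x^*,t^* )\cap(\Omega\times\mathbb{R}^s)$, $$\mathrm{dist}_{\mathcal F'}(x,t)\le\kappa\Bigl(\sum_{i=1}^s|\omega_i(x)-t_i|+\sum_{i\in\mathcal I^c}|t_i-t_i^*|+\|g(x)_+\|+\|h(x)\|\Bigr).$$ *)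

theory Defs
  imports "HOL-Analysis.Analysis" "HOL-Library.Landau_Symbols"
begin

definition is_norm :: "('a::real_vector \<Rightarrow> real) \<Rightarrow> bool" where
  "is_norm N \<longleftrightarrow>
     (\<forall>x. 0 \<le> N x) \<and> (\<forall>x. N x = 0 \<longleftrightarrow> x = 0) \<and>
     (\<forall>c x. N (c *\<^sub>R x) = \<bar>c\<bar> * N x) \<and>
     (\<forall>x y. N (x + y) \<le> N x + N y)"

definition nonneg_part :: "real ^ 'n \<Rightarrow> real ^ 'n" where
  "nonneg_part y = (\<chi> i. max (y $ i) 0)"

definition set_delta :: "'a set \<Rightarrow> 'a \<Rightarrow> ereal" where
  "set_delta \<Omega> x = (if x \<in> \<Omega> then 0 else \<infinity>)"

definition lower_semicontinuous :: "('a::topological_space \<Rightarrow> real) \<Rightarrow> bool" where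
  "lower_semicontinuous \<phi> \<longleftrightarrow> (\<forall>x. ereal (\<phi> x) \<le> Liminf (at x) (\<lambda>y. ereal (\<phi> y)))"

definition lipschitz_around :: "('a::metric_space \<Rightarrow> 'b::metric_space) \<Rightarrow> 'a \<Rightarrow> bool" where
  "lipschitz_around F x \<longleftrightarrow> (\<exists>\<epsilon>>0. \<exists>L. L-lipschitz_on (cball x \<epsilon>) F)"

definition local_minimizer :: "('a::metric_space \<Rightarrow> 'b::order) \<Rightarrow> 'a set \<Rightarrow> 'a \<Rightarrow> bool" where
  "local_minimizer F S x \<longleftrightarrow> x \<in> S \<and> (\<exists>\<epsilon>>0. \<forall>y \<in> S \<inter> cball x \<epsilon>. F x \<le> F y)"

text \<open>The remainder term is an explicit function \<open>r\<close>. The filter \<open>at\<close> ignores the value of \<open>r\<close> at the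
  base point itself, where the inequality just reads \<open>r xbar \<le> 0\<close>.\<close>

definition regular_subdiff :: "('a::real_inner \<Rightarrow> real) \<Rightarrow> 'a \<Rightarrow> 'a set" where
  "regular_subdiff \<phi> xbar =
     {v. \<exists>r. r \<in> o[at xbar](\<lambda>x. norm (x - xbar)) \<and>
             (\<forall>x. \<phi> x \<ge> \<phi> xbar + v \<bullet> (x - xbar) + r x)}"

definition horizon_subdiff :: "('a::real_inner \<Rightarrow> real) \<Rightarrow> 'a \<Rightarrow> 'a set" where
  "horizon_subdiff \<phi> xbar =
     {v. \<exists>(X :: nat \<Rightarrow> 'a) (V :: nat \<Rightarrow> 'a) (T :: nat \<Rightarrow> real).
           X \<longlonglongrightarrow> xbar \<and> (\<lambda>k. \<phi> (X k)) \<longlonglongrightarrow> \<phi> xbar \<and>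
           (\<forall>k. V k \<in> regular_subdiff \<phi> (X k)) \<and>
           (\<forall>k. T k \<ge> 0) \<and> T \<longlonglongrightarrow> 0 \<and> (\<lambda>k. T k *\<^sub>R V k) \<longlonglongrightarrow> v}"

text \<open>In the next two definitions \<open>J\<close> is the set of indices whose component of \<open>t\<close> is frozen at
  \<open>tstar\<close>.\<close>

definition restricted_solutions ::
  "(real ^ 'd \<Rightarrow> real ^ 'n) \<Rightarrow> (real ^ 'd \<Rightarrow> real ^ 'm) \<Rightarrow> (real ^ 'd) set \<Rightarrow>
   ('s \<Rightarrow> real ^ 'd \<Rightarrow> real) \<Rightarrow> 's set \<Rightarrow> real ^ 's \<Rightarrow> ((real ^ 'd) \<times> (real ^ 's)) set" where
  "restricted_solutions g h \<Omega> \<omega> J tstar =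
     {(x, t). g x \<le> 0 \<and> h x = 0 \<and> x \<in> \<Omega> \<and>
              (\<forall>i. \<omega> i x - t $ i = 0) \<and> (\<forall>i\<in>J. t $ i - tstar $ i = 0)}"

text \<open>The metric of the product type is the Euclidean one, so \<open>infdist\<close> is the Euclidean distance
  to a set, while the residuals of \<open>g\<close> and \<open>h\<close>
  are measured in the norms \<open>Ng\<close> and \<open>Nh\<close>.\<close>

definition local_error_bound ::
  "(real ^ 'n \<Rightarrow> real) \<Rightarrow> (real ^ 'm \<Rightarrow> real) \<Rightarrow>
   (real ^ 'd \<Rightarrow> real ^ 'n) \<Rightarrow> (real ^ 'd \<Rightarrow> real ^ 'm) \<Rightarrow> (real ^ 'd) set \<Rightarrow>
   ('s::finite \<Rightarrow> real ^ 'd \<Rightarrow> real) \<Rightarrow> 's set \<Rightarrow> real ^ 'd \<Rightarrow> real ^ 's \<Rightarrow> bool" where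
  "local_error_bound Ng Nh g h \<Omega> \<omega> J xstar tstar \<longleftrightarrow>
     (\<exists>\<delta>>0. \<exists>\<kappa>>0. \<forall>(x, t) \<in> cball (xstar, tstar) \<delta> \<inter> (\<Omega> \<times> UNIV).
        infdist (x, t) (restricted_solutions g h \<Omega> \<omega> J tstar) \<le>
          \<kappa> * ((\<Sum>i\<in>UNIV. \<bar>\<omega> i x - t $ i\<bar>) + (\<Sum>i\<in>J. \<bar>t $ i - tstar $ i\<bar>)
               + Ng (nonneg_part (g x)) + Nh (h x)))"

end

theory Submission
  imports Defs
begin

text \<open>A univariate lower semicontinuous function whose horizon subdifferential is trivial at a point
  is Lipschitz around that point: otherwise perturbed minimization produces nearby regular
  subgradients that are arbitrarily large. At an index of \<open>- I\<close> the function \<open>\<phi> i\<close> grows faster than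
  every linear function. Let \<open>x \<in> \<Omega>\<close> be near \<open>xstar\<close> and let \<open>(x', t')\<close> be an almost nearest solution
  of the restricted system to \<open>(x, \<omega> x)\<close>. Comparing \<open>x\<close> with the feasible point \<open>x'\<close> costs at most a
  multiple of the distance, which the error bound controls. The part of the residual that comes
  from \<open>- I\<close> is absorbed by the growth of \<open>\<phi> i\<close>, the rest by the penalty.\<close>

section \<open>Lower semicontinuous functions\<close>

lemma lower_semicontinuousD:
  assumes "lower_semicontinuous \<phi>" "c < \<phi> x"
  shows "eventually (\<lambda>y. c < \<phi> y) (nhds x)"
proof -
  have "ereal c < Liminf (at x) (\<lambda>y. ereal (\<phi> y))"
    using assms unfolding lower_semicontinuous_def
    by (metis less_le_trans less_ereal.simps(1))
  then have "eventually (\<lambda>y. ereal c < ereal (\<phi> y)) (at x)"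
    by (rule less_LiminfD)
  then have "eventually (\<lambda>y. c < \<phi> y) (at x)"
    by simp
  with assms(2) show ?thesis
    by (simp add: eventually_nhds_conv_at)
qed

text \<open>Reflection lets the estimate for steep increase serve for steep decrease as
  well.\<close>

lemma lower_semicontinuous_reflect:
  fixes \<phi> :: "real \<Rightarrow> real"
  assumes "lower_semicontinuous \<phi>"
  shows "lower_semicontinuous (\<lambda>x. \<phi> (- x))"
  unfolding lower_semicontinuous_def
proof
  fix x :: real
  have "ereal (\<phi> (- x)) \<le> Liminf (at (- x)) (\<lambda>y. ereal (\<phi> y))"
    using assms unfolding lower_semicontinuous_def by blast
  also have "\<dots> = Liminf (at x) (\<lambda>y. ereal (\<phi> (- y)))"
    by (simp add: Liminf_filtermap_eq flip: filtermap_at_minus)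
  finally show "ereal (\<phi> (- x)) \<le> Liminf (at x) (\<lambda>y. ereal (\<phi> (- y)))" .
qed

text \<open>Without a minimizer, the open sets \<open>U y\<close> with \<open>y\<close> in
  \<open>C\<close> would cover \<open>C\<close>. Among the finitely many centres of a subcover, one
  of least value lies in none of the chosen sets.\<close>

lemma lower_semicontinuous_attains_min:
  fixes \<phi> q :: "'a::topological_space \<Rightarrow> real"
  assumes lsc: "lower_semicontinuous \<phi>" and q: "continuous_on UNIV q"
    and C: "compact C" "C \<noteq> {}"
  shows "\<exists>c\<in>C. \<forall>x\<in>C. \<phi> c + q c \<le> \<phi> x + q x"
proof (rule ccontr)
  assume neg: "\<not> ?thesis"
  define U where "U y = {x. \<phi> y + q y < \<phi> x + q x}" for y
  have "open (U y)" for y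
  proof (subst open_subopen, safe)
    fix x assume "x \<in> U y"
    define e where "e = (\<phi> x + q x - \<phi> y - q y) / 2"
    have e: "e > 0" using \<open>x \<in> U y\<close> by (simp add: U_def e_def)
    have "eventually (\<lambda>z. \<phi> x - e < \<phi> z) (nhds x)"
      by (rule lower_semicontinuousD[OF lsc]) (use e in simp)
    moreover have "eventually (\<lambda>z. q x - e < q z) (nhds x)"
    proof -
      have "(q \<longlongrightarrow> q x) (nhds x)"
        using q by (simp add: continuous_on_def tendsto_nhds_iff)
      then show ?thesis by (rule order_tendstoD) (use e in simp)
    qed
    ultimately have "eventually (\<lambda>z. z \<in> U y) (nhds x)"
      by eventually_elim (simp add: U_def e_def field_simps)
    then show "\<exists>T. open T \<and> x \<in> T \<and> T \<subseteq> U y"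
      by (auto simp: eventually_nhds)
  qed
  moreover have "C \<subseteq> (\<Union>y\<in>C. U y)"
    using neg by (auto simp: U_def not_le)
  ultimately obtain F where F: "F \<subseteq> C" "finite F" "C \<subseteq> (\<Union>y\<in>F. U y)"
    using compactE_image[OF C(1)] by metis
  with C(2) have "F \<noteq> {}" by auto
  then obtain y where y: "y \<in> F" "\<forall>z\<in>F. \<phi> y + q y \<le> \<phi> z + q z"
    using F(2) arg_min_if_finite(1)[of F "\<lambda>y. \<phi> y + q y"] arg_min_least[of F _ "\<lambda>y. \<phi> y + q y"]
    by blast
  then show False
    using F by (fastforce simp: U_def)
qed

section \<open>Subgradients and Lipschitz continuity\<close>

lemma regular_subdiff_quadratic_minorant:
  fixes \<phi> :: "'a::real_inner \<Rightarrow> real"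
  assumes "eventually (\<lambda>x. \<phi> c + v \<bullet> (x - c) - N * (norm (x - c))\<^sup>2 \<le> \<phi> x) (nhds c)"
  shows "v \<in> regular_subdiff \<phi> c"
proof -
  \<comment> \<open>Cutting off at 0 makes the subgradient inequality hold at every point by
    construction. The minorant is then needed only near \<open>c\<close>, to bound \<open>r\<close>
    by a quadratic, which is of smaller order than the norm.\<close>
  define r where "r x = min 0 (\<phi> x - \<phi> c - v \<bullet> (x - c))" for x
  have "r \<in> o[at c](\<lambda>x. norm (x - c))"
  proof (rule landau_o.smallI)
    fix e :: real assume e: "e > 0"
    have "((\<lambda>x. \<bar>N\<bar> * norm (x - c)) \<longlongrightarrow> \<bar>N\<bar> * norm (c - c)) (at c)"
      by (intro tendsto_intros)
    then have "eventually (\<lambda>x. \<bar>N\<bar> * norm (x - c) < e) (at c)"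
      by (rule order_tendstoD) (use e in simp)
    moreover have "eventually (\<lambda>x. \<phi> c + v \<bullet> (x - c) - N * (norm (x - c))\<^sup>2 \<le> \<phi> x) (at c)"
      using assms by (simp add: eventually_nhds_conv_at)
    ultimately show "eventually (\<lambda>x. norm (r x) \<le> e * norm (norm (x - c))) (at c)"
    proof eventually_elim
      case (elim x)
      have "N * (norm (x - c))\<^sup>2 \<le> (\<bar>N\<bar> * norm (x - c)) * norm (x - c)"
        by (simp add: power2_eq_square mult_right_mono flip: mult.assoc)
      also have "\<dots> \<le> e * norm (x - c)"
        using elim(1) by (intro mult_right_mono) auto
      finally show ?case
        using elim(2) e unfolding r_def by (auto simp: min_def)
    qed
  qed
  moreover have "\<phi> c + v \<bullet> (x - c) + r x \<le> \<phi> x" for x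
    by (simp add: r_def min_def)
  ultimately show ?thesis
    unfolding regular_subdiff_def by blast
qed

text \<open>Minimize \<open>\<phi> x - M * x\<close> plus a penalty on \<open>{l..b}\<close>.
  Steepness excludes \<open>b\<close> and the penalty excludes \<open>l\<close>, so the minimizer is
  interior, and its optimality, with the penalty expanded there, is the quadratic minorant.\<close>

lemma steep_increase_quadratic_minorant:
  fixes \<phi> :: "real \<Rightarrow> real"
  assumes lsc: "lower_semicontinuous \<phi>" and M: "0 \<le> M" and ab: "l < a" "a < b"
    and steep: "\<phi> a + M * (b - a) < \<phi> b"
  shows "\<exists>c v N. c \<in> {l<..<b} \<and> M \<le> v \<and> \<phi> c \<le> \<phi> a + M * (b - a) \<and>
     (\<forall>x\<in>{l<..<b}. \<phi> c + v * (x - c) - N * (x - c)\<^sup>2 \<le> \<phi> x)"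
proof -
  \<comment> \<open>With this weight the penalized value at \<open>l\<close> exceeds the one at
    \<open>a\<close> by at least 1.\<close>
  define N where "N = (\<bar>\<phi> a - \<phi> l - M * (a - l)\<bar> + 1) / (a - l)\<^sup>2"
  have N: "0 \<le> N" by (simp add: N_def)
  have Nl: "N * (a - l)\<^sup>2 = \<bar>\<phi> a - \<phi> l - M * (a - l)\<bar> + 1"
    using ab by (simp add: N_def)
  \<comment> \<open>The penalty keeps the minimizer away from \<open>l\<close>, and it is decreasing, so that it can only
    increase the subgradient.\<close>
  define q where "q x = N * (max (a - x) 0)\<^sup>2 - M * x" for x
  have "continuous_on UNIV q"
    unfolding q_def by (intro continuous_intros)
  then obtain c where c: "c \<in> {l..b}" and min: "\<And>x. x \<in> {l..b} \<Longrightarrow> \<phi> c + q c \<le> \<phi> x + q x"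
    using lower_semicontinuous_attains_min[OF lsc, of q "{l..b}"] ab by auto
  have ca: "\<phi> c + q c \<le> \<phi> a + q a"
    by (rule min) (use ab in simp)
  have "c \<noteq> l"
    using ca Nl ab by (auto simp: q_def algebra_simps)
  moreover have "c \<noteq> b"
    using ca steep ab by (auto simp: q_def algebra_simps)
  ultimately have c': "c \<in> {l<..<b}"
    using c by auto
  define u where "u = max (a - c) 0"
  have "\<phi> c + N * (max (a - c) 0)\<^sup>2 \<le> \<phi> a + M * (c - a)"
    using ca by (simp add: q_def algebra_simps)
  then have "\<phi> c \<le> \<phi> a + M * (c - a)"
    using mult_nonneg_nonneg[OF N zero_le_power2[of "max (a - c) 0"]] by linarith
  also have "\<dots> \<le> \<phi> a + M * (b - a)"
    using M c by (auto intro: mult_left_mono)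
  finally have le: "\<phi> c \<le> \<phi> a + M * (b - a)" .
  have "\<phi> c + (M + 2 * N * u) * (x - c) - N * (x - c)\<^sup>2 \<le> \<phi> x" if "x \<in> {l<..<b}" for x
  proof -
    \<comment> \<open>The squared positive part is dominated by a parabola that agrees with it at
      \<open>c\<close>. Its linear term contributes \<open>2 * N * u\<close> to the slope, its
      quadratic term the loss \<open>N * (x - c)\<^sup>2\<close>.\<close>
    have "max (a - x) 0 \<le> \<bar>u - (x - c)\<bar>"
      by (auto simp: u_def)
    then have "(max (a - x) 0)\<^sup>2 \<le> (u - (x - c))\<^sup>2"
      by (metis abs_le_square_iff abs_of_nonneg max.cobounded2)
    then have "N * (max (a - x) 0)\<^sup>2 \<le> N * (u - (x - c))\<^sup>2"
      using N by (rule mult_left_mono)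
    moreover have "\<phi> c + q c \<le> \<phi> x + q x"
      by (rule min) (use that in simp)
    ultimately show ?thesis
      by (simp add: q_def power2_eq_square algebra_simps flip: u_def)
  qed
  moreover have "M \<le> M + 2 * N * u"
    using N by (simp add: u_def)
  ultimately show ?thesis
    using c' le by blast
qed

text \<open>A mean value inequality: a violation would yield a subgradient of modulus at least
  \<open>M\<close>. The bound on subgradients is asked only where \<open>\<phi>\<close> is not too
  large, because horizon subgradients see only points whose values are close to
  \<open>\<phi> t\<close>.\<close>

lemma slope_le_of_bounded_subdiff:
  fixes \<phi> :: "real \<Rightarrow> real"
  assumes lsc: "lower_semicontinuous \<phi>" and M: "0 \<le> M"
    and a: "\<bar>a - t\<bar> < \<eta>" and b: "\<bar>b - t\<bar> < \<eta>"
    and bounded: "\<And>c v. \<bar>c - t\<bar> < \<eta> \<Longrightarrow> \<phi> c \<le> \<phi> a + M * \<bar>b - a\<bar> \<Longrightarrow>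
      v \<in> regular_subdiff \<phi> c \<Longrightarrow> \<bar>v\<bar> < M"
  shows "\<phi> b \<le> \<phi> a + M * \<bar>b - a\<bar>"
proof (rule ccontr)
  assume "\<not> ?thesis"
  then have steep: "\<phi> a + M * \<bar>b - a\<bar> < \<phi> b" by simp
  have no_minorant: False
    if "c \<in> {l<..<r}" "\<bar>c - t\<bar> < \<eta>" "M \<le> \<bar>v\<bar>" "\<phi> c \<le> \<phi> a + M * \<bar>b - a\<bar>"
      "\<And>x. x \<in> {l<..<r} \<Longrightarrow> \<phi> c + v * (x - c) - N * (x - c)\<^sup>2 \<le> \<phi> x" for c v N l r
  proof -
    have "eventually (\<lambda>x. x \<in> {l<..<r}) (nhds c)"
      using that(1) by (intro eventually_nhds_in_open) auto
    then have "eventually (\<lambda>x. \<phi> c + v \<bullet> (x - c) - N * (norm (x - c))\<^sup>2 \<le> \<phi> x) (nhds c)"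
      by eventually_elim (use that(5) in simp)
    then have "v \<in> regular_subdiff \<phi> c"
      by (rule regular_subdiff_quadratic_minorant)
    then show False
      using bounded[of c v] that by auto
  qed
  consider "a < b" | "b < a" using steep by fastforce
  then show False
  proof cases
    case 1
    have "\<exists>c v N. c \<in> {t - \<eta><..<b} \<and> M \<le> v \<and> \<phi> c \<le> \<phi> a + M * (b - a) \<and>
       (\<forall>x\<in>{t - \<eta><..<b}. \<phi> c + v * (x - c) - N * (x - c)\<^sup>2 \<le> \<phi> x)"
      by (rule steep_increase_quadratic_minorant[OF lsc M]) (use a steep 1 in auto)
    then obtain c v N where "c \<in> {t - \<eta><..<b}" "M \<le> v" "\<phi> c \<le> \<phi> a + M * (b - a)"
      "\<And>x. x \<in> {t - \<eta><..<b} \<Longrightarrow> \<phi> c + v * (x - c) - N * (x - c)\<^sup>2 \<le> \<phi> x" by blast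
    then show False
      using b 1 by (intro no_minorant[of c "t - \<eta>" b v N]) auto
  next
    case 2
    \<comment> \<open>A steep decrease is a steep increase of the reflected function. Reflecting
      back changes the sign of the slope but not its modulus.\<close>
    have "\<exists>c v N. c \<in> {- t - \<eta><..<- b} \<and> M \<le> v \<and> \<phi> (- c) \<le> \<phi> (- (- a)) + M * (- b - - a) \<and>
       (\<forall>x\<in>{- t - \<eta><..<- b}. \<phi> (- c) + v * (x - c) - N * (x - c)\<^sup>2 \<le> \<phi> (- x))"
      by (rule steep_increase_quadratic_minorant[OF lower_semicontinuous_reflect[OF lsc] M])
        (use a steep 2 in auto)
    then obtain c v N where c: "c \<in> {- t - \<eta><..<- b}" "M \<le> v" "\<phi> (- c) \<le> \<phi> a + M * (a - b)"
      and minorant: "\<forall>x\<in>{- t - \<eta><..<- b}.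
        \<phi> (- c) + v * (x - c) - N * (x - c)\<^sup>2 \<le> \<phi> (- x)" by auto
    have "\<phi> (- c) + (- v) * (x - - c) - N * (x - - c)\<^sup>2 \<le> \<phi> x" if "x \<in> {b<..<t + \<eta>}" for x
      using bspec[OF minorant, of "- x"] that by (simp add: power2_eq_square algebra_simps)
    then show False
      using c b 2 by (intro no_minorant[of "- c" b "t + \<eta>" "- v" N]) auto
  qed
qed

text \<open>Unbounded subgradients at points converging to \<open>x\<close> together with their
  values can be scaled by their inverse norms. By compactness of the sphere a subsequence converges
  to a unit vector, which is a nonzero horizon subgradient.\<close>

lemma horizon_subdiff_trivial_imp_bounded:
  fixes \<phi> :: "'a::euclidean_space \<Rightarrow> real"
  assumes "horizon_subdiff \<phi> x \<subseteq> {0}"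
  shows "\<exists>\<delta>>0. \<exists>K. \<forall>y v. dist y x < \<delta> \<longrightarrow> \<bar>\<phi> y - \<phi> x\<bar> < \<delta> \<longrightarrow>
    v \<in> regular_subdiff \<phi> y \<longrightarrow> norm v < K"
proof (rule ccontr)
  assume neg: "\<not> ?thesis"
  have "\<exists>y v. dist y x < 1 / real (Suc k) \<and> \<bar>\<phi> y - \<phi> x\<bar> < 1 / real (Suc k) \<and>
      v \<in> regular_subdiff \<phi> y \<and> real (Suc k) \<le> norm v" for k
  proof -
    have "0 < 1 / real (Suc k)" by simp
    then show ?thesis using neg by (meson not_less)
  qed
  then obtain X V where X: "\<And>k. dist (X k) x < 1 / real (Suc k)"
    and \<phi>X: "\<And>k. \<bar>\<phi> (X k) - \<phi> x\<bar> < 1 / real (Suc k)"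
    and V: "\<And>k. V k \<in> regular_subdiff \<phi> (X k)" "\<And>k. real (Suc k) \<le> norm (V k)"
    by metis
  have null: "(\<lambda>k. 1 / real (Suc k)) \<longlonglongrightarrow> 0"
    using LIMSEQ_inverse_real_of_nat by (simp add: inverse_eq_divide)
  have "X \<longlonglongrightarrow> x"
    by (rule tendstoI, rule eventually_mono[OF order_tendstoD(2)[OF null]])
      (auto intro: less_trans X)
  have "(\<lambda>k. \<phi> (X k)) \<longlonglongrightarrow> \<phi> x"
    by (rule tendstoI, rule eventually_mono[OF order_tendstoD(2)[OF null]])
      (auto simp: dist_real_def intro: less_trans \<phi>X)
  have "(\<lambda>k. inverse (norm (V k))) \<longlonglongrightarrow> 0"
  proof (rule tendsto_sandwich[OF _ _ tendsto_const null])
    have "inverse (norm (V k)) \<le> 1 / real (Suc k)" for k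
      using V(2)[of k] le_imp_inverse_le[of "real (Suc k)"] by (simp add: inverse_eq_divide)
    then show "eventually (\<lambda>k. inverse (norm (V k)) \<le> 1 / real (Suc k)) sequentially"
      by simp
  qed auto
  have "V k \<noteq> 0" for k
    using V(2)[of k] by auto
  then have unit: "inverse (norm (V k)) *\<^sub>R V k \<in> sphere 0 1" for k
    by simp
  obtain w s where w: "w \<in> sphere 0 1" and s: "strict_mono (s :: nat \<Rightarrow> nat)"
    and lim: "((\<lambda>k. inverse (norm (V k)) *\<^sub>R V k) \<circ> s) \<longlonglongrightarrow> w"
    using seq_compactE[OF compact_imp_seq_compact[OF compact_sphere[of "0::'a" 1]],
      of "\<lambda>k. inverse (norm (V k)) *\<^sub>R V k"] unit
    by blast
  have "w \<in> horizon_subdiff \<phi> x"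
    unfolding horizon_subdiff_def mem_Collect_eq
  proof (intro exI conjI)
    show "(X \<circ> s) \<longlonglongrightarrow> x"
      by (rule LIMSEQ_subseq_LIMSEQ) fact+
    show "(\<lambda>k. \<phi> ((X \<circ> s) k)) \<longlonglongrightarrow> \<phi> x"
      using LIMSEQ_subseq_LIMSEQ[OF \<open>(\<lambda>k. \<phi> (X k)) \<longlonglongrightarrow> \<phi> x\<close> s] by (simp add: o_def)
    show "((\<lambda>k. inverse (norm (V k))) \<circ> s) \<longlonglongrightarrow> 0"
      by (rule LIMSEQ_subseq_LIMSEQ) fact+
    show "(\<lambda>k. ((\<lambda>k. inverse (norm (V k))) \<circ> s) k *\<^sub>R (V \<circ> s) k) \<longlonglongrightarrow> w"
      using lim by (simp add: o_def)
  qed (use V in auto)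
  with assms w show False by auto
qed

text \<open>Semicontinuity bounds nearby values only from below, so the slope estimate is first
  available from starting points of controlled value. Starting at \<open>t\<close> itself, it shows
  that all nearby values are controlled, and then it holds for all pairs.\<close>

lemma horizon_subdiff_trivial_imp_lipschitz:
  fixes \<phi> :: "real \<Rightarrow> real"
  assumes lsc: "lower_semicontinuous \<phi>" and hor: "horizon_subdiff \<phi> t \<subseteq> {0}"
  shows "\<exists>\<eta>>0. \<exists>M\<ge>0. \<forall>a b. \<bar>a - t\<bar> < \<eta> \<longrightarrow> \<bar>b - t\<bar> < \<eta> \<longrightarrow> \<phi> b \<le> \<phi> a + M * \<bar>b - a\<bar>"
proof -
  obtain \<delta> K where \<delta>: "\<delta> > 0" and K: "\<And>y v. \<lbrakk>\<bar>y - t\<bar> < \<delta>; \<bar>\<phi> y - \<phi> t\<bar> < \<delta>;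
      v \<in> regular_subdiff \<phi> y\<rbrakk> \<Longrightarrow> \<bar>v\<bar> < K"
    using horizon_subdiff_trivial_imp_bounded[OF hor] by (auto simp: dist_real_def)
  define M where "M = max K 1"
  have M: "M > 0" by (simp add: M_def)
  have "eventually (\<lambda>y. \<phi> t - \<delta> < \<phi> y) (nhds t)"
    by (rule lower_semicontinuousD[OF lsc]) (use \<delta> in simp)
  then obtain \<eta>0 where \<eta>0: "\<eta>0 > 0" "\<And>y. \<bar>y - t\<bar> < \<eta>0 \<Longrightarrow> \<phi> t - \<delta> < \<phi> y"
    unfolding eventually_nhds_metric by (auto simp: dist_real_def)
  \<comment> \<open>Two points within \<open>\<eta>\<close> of \<open>t\<close> are less than
    \<open>2 * \<eta>\<close> apart, so slope \<open>M\<close> between them costs at most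
    \<open>\<delta> / 2\<close>. From a value below \<open>\<phi> t + \<delta> / 2\<close> one thus
    stays below \<open>\<phi> t + \<delta>\<close>.\<close>
  define \<eta> where "\<eta> = min (min \<eta>0 \<delta>) (\<delta> / (4 * M))"
  have \<eta>: "\<eta> > 0" "\<eta> \<le> \<eta>0" "\<eta> \<le> \<delta>" "\<eta> \<le> \<delta> / (4 * M)"
    using \<eta>0 \<delta> M by (auto simp: \<eta>_def)
  have M\<eta>: "M * \<eta> \<le> \<delta> / 4"
    using \<eta>(4) M by (simp add: field_simps)
  have slope: "\<phi> b \<le> \<phi> a + M * \<bar>b - a\<bar>"
    if a: "\<bar>a - t\<bar> < \<eta>" "\<phi> a < \<phi> t + \<delta> / 2" and b: "\<bar>b - t\<bar> < \<eta>" for a b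
  proof (rule slope_le_of_bounded_subdiff[OF lsc _ a(1) b])
    fix c v assume c: "\<bar>c - t\<bar> < \<eta>" "\<phi> c \<le> \<phi> a + M * \<bar>b - a\<bar>" "v \<in> regular_subdiff \<phi> c"
    have "M * \<bar>b - a\<bar> \<le> M * (2 * \<eta>)"
      using a b M by (intro mult_left_mono) auto
    then have "\<phi> c < \<phi> t + \<delta>"
      using c(2) a(2) M\<eta> by simp
    moreover have "\<phi> t - \<delta> < \<phi> c"
      by (rule \<eta>0(2)) (use c \<eta> in simp)
    ultimately have "\<bar>v\<bar> < K"
      using c \<eta> by (intro K[of c v]) auto
    then show "\<bar>v\<bar> < M" by (simp add: M_def)
  qed (use M in simp)
  have "\<phi> a < \<phi> t + \<delta> / 2" if "\<bar>a - t\<bar> < \<eta>" for a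
  proof -
    have "\<phi> a \<le> \<phi> t + M * \<bar>a - t\<bar>"
      by (rule slope) (use that \<eta> \<delta> in auto)
    also have "\<dots> \<le> \<phi> t + M * \<eta>"
      using that M by (intro add_left_mono mult_left_mono) auto
    finally show ?thesis using M\<eta> \<delta> by simp
  qed
  then show ?thesis
    using slope \<eta>(1) M by (meson less_imp_le)
qed

lemma regular_subdiff_UNIV_imp_superlinear_growth:
  fixes \<phi> :: "real \<Rightarrow> real"
  assumes "regular_subdiff \<phi> t = UNIV"
  shows "eventually (\<lambda>y. \<phi> t + K * \<bar>y - t\<bar> \<le> \<phi> y) (nhds t)"
proof -
  have linear: "eventually (\<lambda>y. \<phi> t + v * (y - t) - \<bar>y - t\<bar> \<le> \<phi> y) (at t)" for v
  proof -
    have "v \<in> regular_subdiff \<phi> t" using assms by simp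
    then obtain r where r: "r \<in> o[at t](\<lambda>x. norm (x - t))"
      and le: "\<And>x. \<phi> t + v * (x - t) + r x \<le> \<phi> x"
      unfolding regular_subdiff_def by auto
    have "eventually (\<lambda>x. norm (r x) \<le> 1 * norm (norm (x - t))) (at t)"
      by (rule landau_o.smallD[OF r]) simp
    then show ?thesis
    proof eventually_elim
      case (elim x)
      then show ?case using le[of x] by (simp add: abs_le_iff)
    qed
  qed
  \<comment> \<open>One slope serves to the right of \<open>t\<close>, the other to the left. The
    excess of 1 over \<open>K\<close> absorbs the remainder.\<close>
  have "eventually (\<lambda>y. \<phi> t + K * \<bar>y - t\<bar> \<le> \<phi> y) (at t)"
    using linear[of "K + 1"] linear[of "- (K + 1)"]
    by eventually_elim (auto simp: abs_if algebra_simps split: if_splits)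
  then show ?thesis
    by (simp add: eventually_nhds_conv_at)
qed

section \<open>Exact penalization\<close>

lemma local_minimizer_ereal_sum_set_delta:
  fixes \<phi> :: "'s::finite \<Rightarrow> real \<Rightarrow> real"
  assumes "local_minimizer (\<lambda>x. ereal (f x) + ((\<Sum>i\<in>UNIV. ereal (\<phi> i (\<omega> i x))) + set_delta \<Omega> x)) S z"
    and "z \<in> \<Omega>"
  shows "local_minimizer (\<lambda>x. f x + (\<Sum>i\<in>UNIV. \<phi> i (\<omega> i x))) (S \<inter> \<Omega>) z"
proof -
  obtain e where z: "z \<in> S" and e: "e > 0" and min: "\<And>y. y \<in> S \<inter> cball z e \<Longrightarrow>
      ereal (f z) + ((\<Sum>i\<in>UNIV. ereal (\<phi> i (\<omega> i z))) + set_delta \<Omega> z)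
      \<le> ereal (f y) + ((\<Sum>i\<in>UNIV. ereal (\<phi> i (\<omega> i y))) + set_delta \<Omega> y)"
    using assms(1) unfolding local_minimizer_def by blast
  have "f z + (\<Sum>i\<in>UNIV. \<phi> i (\<omega> i z)) \<le> f y + (\<Sum>i\<in>UNIV. \<phi> i (\<omega> i y))"
    if "y \<in> S \<inter> \<Omega> \<inter> cball z e" for y
    using min[of y] that assms(2) by (simp add: set_delta_def)
  then show ?thesis
    using z e assms(2) unfolding local_minimizer_def by blast
qed

theorem theorem2:
  fixes f :: "real ^ 'd \<Rightarrow> real"
    and g :: "real ^ 'd \<Rightarrow> real ^ 'n"
    and h :: "real ^ 'd \<Rightarrow> real ^ 'm"
    and \<Omega> :: "(real ^ 'd) set"
    and \<phi> :: "'s::finite \<Rightarrow> real \<Rightarrow> real"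
    and \<omega> :: "'s \<Rightarrow> real ^ 'd \<Rightarrow> real"
    and \<Phi> :: "real ^ 'd \<Rightarrow> ereal"
    and xstar :: "real ^ 'd" and tstar :: "real ^ 's"
    and I :: "'s set"
    and Ng :: "real ^ 'n \<Rightarrow> real" and Nh :: "real ^ 'm \<Rightarrow> real"
  assumes "is_norm Ng" and "is_norm Nh"
    and "closed \<Omega>"
    and "\<And>i. lower_semicontinuous (\<phi> i)"
    and "\<And>i. continuous_on UNIV (\<omega> i)"
    and "\<Phi> = (\<lambda>x. (\<Sum>i\<in>UNIV. ereal (\<phi> i (\<omega> i x))) + set_delta \<Omega> x)"
    and "local_minimizer (\<lambda>x. ereal (f x) + \<Phi> x) {x. g x \<le> 0 \<and> h x = 0} xstar"
    and "xstar \<in> \<Omega>"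
    and "lipschitz_around f xstar" and "lipschitz_around g xstar" and "lipschitz_around h xstar"
    and "tstar = (\<chi> i. \<omega> i xstar)"
    and "I = {i. horizon_subdiff (\<phi> i) (tstar $ i) = {0}}"
    and "\<And>i. i \<in> - I \<Longrightarrow> regular_subdiff (\<phi> i) (tstar $ i) = UNIV"
    and "local_error_bound Ng Nh g h \<Omega> \<omega> (- I) xstar tstar"
  shows "\<exists>\<rho>0>0. \<forall>\<rho>\<ge>\<rho>0.
           local_minimizer
             (\<lambda>x. f x + (\<Sum>i\<in>UNIV. \<phi> i (\<omega> i x)) + \<rho> * (Ng (nonneg_part (g x)) + Nh (h x)))
             \<Omega> xstar"
proof -
  define G where "G = (\<lambda>x. f x + (\<Sum>i\<in>UNIV. \<phi> i (\<omega> i x)))"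
  define P where "P x = Ng (nonneg_part (g x)) + Nh (h x)" for x
  define F where "F = restricted_solutions g h \<Omega> \<omega> (- I) tstar"
  have "local_minimizer G ({x. g x \<le> 0 \<and> h x = 0} \<inter> \<Omega>) xstar"
    unfolding G_def using assms(6-8) by (intro local_minimizer_ereal_sum_set_delta) auto
  then obtain e0 where feas: "g xstar \<le> 0" "h xstar = 0" and e0: "e0 > 0"
    and min: "\<And>y. g y \<le> 0 \<Longrightarrow> h y = 0 \<Longrightarrow> y \<in> \<Omega> \<Longrightarrow> dist xstar y \<le> e0 \<Longrightarrow> G xstar \<le> G y"
    unfolding local_minimizer_def by auto
  have P0: "P xstar = 0"
  proof -
    have "nonneg_part (g xstar) = 0"
      using feas by (auto simp: nonneg_part_def vec_eq_iff less_eq_vec_def max_def intro: antisym)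
    moreover have "Ng 0 = 0" "Nh 0 = 0"
      using assms(1,2) unfolding is_norm_def by blast+
    ultimately show ?thesis
      using feas by (simp add: P_def)
  qed
  have P_nonneg: "0 \<le> P x" for x
    using assms(1,2) by (simp add: P_def is_norm_def)
  have t: "tstar $ i = \<omega> i xstar" for i
    using assms(12) by simp

  obtain ef Lf where ef: "ef > 0" and Lf: "Lf-lipschitz_on (cball xstar ef) f"
    using assms(9) unfolding lipschitz_around_def by blast
  \<comment> \<open>The condition \<open>i \<in> I\<close> stands inside the existential so that
    \<open>\<eta>\<close> and \<open>M\<close> become functions on all indices; off \<open>I\<close>
    their values are mere placeholders.\<close>
  have "\<exists>\<eta>>0. \<exists>M\<ge>0. i \<in> I \<longrightarrow> (\<forall>a b. \<bar>a - tstar $ i\<bar> < \<eta> \<longrightarrow> \<bar>b - tstar $ i\<bar> < \<eta> \<longrightarrow>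
      \<phi> i b \<le> \<phi> i a + M * \<bar>b - a\<bar>)" for i
  proof (cases "i \<in> I")
    case True
    then have "horizon_subdiff (\<phi> i) (tstar $ i) \<subseteq> {0}"
      using assms(13) by auto
    from horizon_subdiff_trivial_imp_lipschitz[OF assms(4) this] show ?thesis
      by blast
  qed (auto intro: exI[of _ 1])
  then obtain \<eta> M where \<eta>: "\<And>i. \<eta> i > 0" and M: "\<And>i. 0 \<le> M i"
    and lip: "\<And>i a b. i \<in> I \<Longrightarrow> \<bar>a - tstar $ i\<bar> < \<eta> i \<Longrightarrow> \<bar>b - tstar $ i\<bar> < \<eta> i \<Longrightarrow>
      \<phi> i b \<le> \<phi> i a + M i * \<bar>b - a\<bar>"
    by metis
  obtain \<delta> \<kappa> where \<delta>: "\<delta> > 0" and \<kappa>: "\<kappa> > 0"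
    and eb: "\<And>x t. (x, t) \<in> cball (xstar, tstar) \<delta> \<Longrightarrow> x \<in> \<Omega> \<Longrightarrow> infdist (x, t) F \<le>
      \<kappa> * ((\<Sum>i\<in>UNIV. \<bar>\<omega> i x - t $ i\<bar>) + (\<Sum>i\<in>-I. \<bar>t $ i - tstar $ i\<bar>) + P x)"
    using assms(15) unfolding local_error_bound_def F_def P_def
    by (fastforce simp: add.assoc)

  \<comment> \<open>The rise of \<open>f\<close> and of the \<open>\<phi> i\<close> with
    \<open>i \<in> I\<close> per unit of distance between lifted points
    \<open>(x, \<omega> x)\<close>.\<close>
  define L where "L = Lf + (\<Sum>i\<in>I. M i)"
  have L: "0 \<le> L"
    using lipschitz_on_nonneg[OF Lf] M by (simp add: L_def sum_nonneg)
  define r where "r = Min (insert e0 (insert ef (insert \<delta> (range \<eta>))))"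
  have r: "r > 0" "r \<le> e0" "r \<le> ef" "r \<le> \<delta>" and r\<eta>: "\<And>i. r \<le> \<eta> i"
    unfolding r_def using e0 ef \<delta> \<eta> by (auto intro!: Min_le simp del: Min_insert)

  define W where "W x = (\<chi> i. \<omega> i x)" for x
  have W0: "W xstar = tstar"
    by (simp add: W_def assms(12))
  have "continuous_on UNIV (\<lambda>x. (x, W x))"
    unfolding W_def by (intro continuous_intros assms(5))
  then have cont: "((\<lambda>x. (x, W x)) \<longlongrightarrow> (xstar, tstar)) (nhds xstar)"
    using W0 by (auto simp: continuous_on_eq_continuous_at tendsto_nhds_iff continuous_at)
  \<comment> \<open>A quarter suffices: an almost nearest solution with error below
    \<open>r / 4\<close> is within \<open>r / 2\<close> of the lifted point, hence within
    \<open>r\<close> of \<open>(xstar, tstar)\<close>.\<close>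
  have near: "eventually (\<lambda>x. dist (x, W x) (xstar, tstar) < r / 4) (nhds xstar)"
    using tendstoD[OF cont, of "r / 4"] r by simp
  \<comment> \<open>The slope \<open>L * \<kappa>\<close> is the price of one unit of residual: the
    error bound turns it into distance \<open>\<kappa>\<close>, which costs \<open>L\<close>
    each.\<close>
  have growth: "eventually (\<lambda>x. \<forall>i\<in>-I. \<phi> i (tstar $ i) + (L * \<kappa>) * \<bar>\<omega> i x - tstar $ i\<bar> \<le> \<phi> i (\<omega> i x))
      (nhds xstar)"
  proof (intro eventually_ball_finite ballI)
    fix i assume "i \<in> - I"
    have "(\<omega> i \<longlongrightarrow> tstar $ i) (nhds xstar)"
      using assms(5)[of i] by (simp add: t continuous_on_eq_continuous_at tendsto_nhds_iff continuous_at)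
    then show "eventually (\<lambda>x. \<phi> i (tstar $ i) + (L * \<kappa>) * \<bar>\<omega> i x - tstar $ i\<bar> \<le> \<phi> i (\<omega> i x)) (nhds xstar)"
      using eventually_compose_filterlim
        [OF regular_subdiff_UNIV_imp_superlinear_growth[OF assms(14)[OF \<open>i \<in> - I\<close>]]] by fast
  qed simp

  have key: "G xstar \<le> G x + L * \<kappa> * P x"
    if x: "x \<in> \<Omega>" and nx: "dist (x, W x) (xstar, tstar) < r / 4"
      and gx: "\<forall>i\<in>-I. \<phi> i (tstar $ i) + (L * \<kappa>) * \<bar>\<omega> i x - tstar $ i\<bar> \<le> \<phi> i (\<omega> i x)" for x
  proof -
    define R where "R = (\<Sum>i\<in>-I. \<bar>\<omega> i x - tstar $ i\<bar>)"
    \<comment> \<open>Since \<open>F\<close> is nonempty, \<open>infdist\<close> is a true infimum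
      and not its default value 0.\<close>
    have star: "(xstar, tstar) \<in> F"
      using feas assms(8) by (simp add: F_def restricted_solutions_def t)
    have "(x, W x) \<in> cball (xstar, tstar) \<delta>"
      using nx r by (simp add: dist_commute)
    \<comment> \<open>At a lifted point the residuals of the equations
      \<open>\<omega> i x = t $ i\<close> vanish, so only \<open>R\<close> and \<open>P x\<close>
      remain.\<close>
    from eb[OF this x] have inf: "infdist (x, W x) F \<le> \<kappa> * (R + P x)"
      by (simp add: W_def R_def)
    \<comment> \<open>\<open>F\<close> is not known to be closed, as \<open>g\<close> and
      \<open>h\<close> are arbitrary away from \<open>xstar\<close>. The slack \<open>e\<close>
      replaces an exact projection and tends to 0 afterwards.\<close>
    have approx: "G xstar \<le> G x + L * \<kappa> * P x + L * e" if e: "0 < e" "e < r / 4" for e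
    proof -
      have "infdist (x, W x) F < infdist (x, W x) F + e" using e by simp
      then obtain x' t' where F': "(x', t') \<in> F"
        and d: "dist (x, W x) (x', t') < infdist (x, W x) F + e"
        using star by (metis cINF_less_iff bdd_below_image_dist empty_iff infdist_notempty surj_pair)
      define D where "D = dist (x, W x) (x', t')"
      have D: "D \<le> \<kappa> * (R + P x) + e"
        using d inf by (simp add: D_def)
      \<comment> \<open>Since \<open>(xstar, tstar)\<close> is itself a solution, the almost nearest one stays close to it.\<close>
      have "D < r / 2"
        using d nx e infdist_le[OF star, of "(x, W x)"] by (simp add: D_def)
      then have n': "dist (x', t') (xstar, tstar) < r"
        using nx dist_triangle2[of "(x', t')" "(xstar, tstar)" "(x, W x)"]
          dist_triangle[of "(x', t')" "(xstar, tstar)" "(x, W x)"] r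
        by (simp add: D_def dist_commute)
      have nx': "dist x' xstar < r" "dist x xstar < r"
        using n' nx dist_fst_le[of "(x', t')" "(xstar, tstar)"]
          dist_fst_le[of "(x, W x)" "(xstar, tstar)"] r by simp_all
      have comp: "\<bar>p $ i - q $ i\<bar> \<le> dist (y, p) (z, q)" for p q :: "real ^ 's" and y z :: "real ^ 'd" and i
        using dist_snd_le[of "(y, p)" "(z, q)"] component_le_norm_cart[of "p - q" i]
        by (simp add: dist_norm)
      have sol: "g x' \<le> 0" "h x' = 0" "x' \<in> \<Omega>" "\<And>i. t' $ i = \<omega> i x'" "\<And>i. i \<in> - I \<Longrightarrow> \<omega> i x' = tstar $ i"
        using F' by (auto simp: F_def restricted_solutions_def)
      have f: "f x' \<le> f x + Lf * D"
      proof -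
        have "dist (f x') (f x) \<le> Lf * dist x' x"
          using nx' r by (intro lipschitz_onD[OF Lf]) (auto simp: dist_commute)
        also have "\<dots> \<le> Lf * D"
          using lipschitz_on_nonneg[OF Lf] dist_fst_le[of "(x, W x)" "(x', t')"]
          by (intro mult_left_mono) (auto simp: D_def dist_commute)
        finally show ?thesis by (simp add: dist_real_def)
      qed
      have I: "(\<Sum>i\<in>I. \<phi> i (\<omega> i x')) \<le> (\<Sum>i\<in>I. \<phi> i (\<omega> i x)) + (\<Sum>i\<in>I. M i) * D"
        unfolding sum_distrib_right sum.distrib[symmetric]
      proof (rule sum_mono)
        fix i assume i: "i \<in> I"
        \<comment> \<open>Both numbers are components of the lifted points, so their difference is
          bounded by the distance \<open>D\<close> in the product space.\<close>
        have c1: "\<bar>\<omega> i x - \<omega> i x'\<bar> \<le> D"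
          using comp[of "W x" i t' x x'] by (simp add: W_def sol D_def)
        have "\<bar>\<omega> i x' - tstar $ i\<bar> < \<eta> i" "\<bar>\<omega> i x - tstar $ i\<bar> < \<eta> i"
          using comp[of t' i tstar x' xstar] comp[of "W x" i tstar x xstar] n' nx r(1) r\<eta>[of i]
          by (simp_all add: W_def sol)
        then have "\<phi> i (\<omega> i x') \<le> \<phi> i (\<omega> i x) + M i * \<bar>\<omega> i x' - \<omega> i x\<bar>"
          by (intro lip i)
        also have "\<dots> \<le> \<phi> i (\<omega> i x) + M i * D"
          using c1 M[of i] by (intro add_left_mono mult_left_mono) auto
        finally show "\<phi> i (\<omega> i x') \<le> \<phi> i (\<omega> i x) + M i * D" .
      qed
      \<comment> \<open>At the solution these components are frozen at \<open>tstar\<close>, so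
        passing from \<open>x\<close> to \<open>x'\<close> gains the whole superlinear
        growth.\<close>
      have C: "(\<Sum>i\<in>-I. \<phi> i (\<omega> i x')) + L * \<kappa> * R \<le> (\<Sum>i\<in>-I. \<phi> i (\<omega> i x))"
        unfolding R_def sum_distrib_left sum.distrib[symmetric]
        using gx sol(5) by (intro sum_mono) auto
      have split: "sum u UNIV = sum u I + sum u (- I)" for u :: "'s \<Rightarrow> real"
        by (metis Compl_disjoint Compl_partition finite sum.union_disjoint)
      have "G xstar \<le> G x'"
        using nx' r by (intro min sol) (auto simp: dist_commute)
      also have "\<dots> \<le> G x + L * D - L * \<kappa> * R"
        using f I C by (simp add: G_def split L_def algebra_simps)
      \<comment> \<open>The cost \<open>L * \<kappa> * R\<close> from the error bound cancels
        against the gain on \<open>- I\<close>; only the penalty term and the slack survive.\<close>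
      also have "\<dots> \<le> G x + L * (\<kappa> * (R + P x) + e) - L * \<kappa> * R"
        using mult_left_mono[OF D L] by simp
      finally show ?thesis by (simp add: algebra_simps)
    qed
    have "((\<lambda>e. G x + L * \<kappa> * P x + L * e) \<longlongrightarrow> G x + L * \<kappa> * P x + L * 0) (at_right 0)"
      by (intro tendsto_intros)
    moreover have "eventually (\<lambda>e. G xstar \<le> G x + L * \<kappa> * P x + L * e) (at_right 0)"
      unfolding eventually_at_right_field using approx r by (intro exI[of _ "r / 4"]) auto
    ultimately have "G xstar \<le> G x + L * \<kappa> * P x + L * 0"
      by (rule tendsto_lowerbound) simp
    then show ?thesis by simp
  qed
  have "eventually (\<lambda>x. x \<in> \<Omega> \<longrightarrow> G xstar \<le> G x + L * \<kappa> * P x) (nhds xstar)"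
    using near growth by eventually_elim (use key in blast)
  then obtain \<epsilon> where \<epsilon>: "\<epsilon> > 0"
    "\<And>x. dist x xstar \<le> \<epsilon> \<Longrightarrow> x \<in> \<Omega> \<Longrightarrow> G xstar \<le> G x + L * \<kappa> * P x"
    unfolding eventually_nhds_metric_le by blast
  \<comment> \<open>The summand 1 keeps the threshold positive even when \<open>L\<close> is
    0.\<close>
  have "local_minimizer (\<lambda>x. G x + \<rho> * P x) \<Omega> xstar" if "\<rho> \<ge> L * \<kappa> + 1" for \<rho>
  proof -
    have "G xstar + \<rho> * P xstar \<le> G x + \<rho> * P x" if "x \<in> \<Omega>" "dist x xstar \<le> \<epsilon>" for x
    proof -
      have "L * \<kappa> * P x \<le> \<rho> * P x"
        using \<open>\<rho> \<ge> L * \<kappa> + 1\<close> P_nonneg by (intro mult_right_mono) auto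
      then show ?thesis
        using \<epsilon>(2)[OF that(2,1)] P0 by simp
    qed
    then show ?thesis
      unfolding local_minimizer_def using assms(8) \<epsilon>(1) by (auto simp: dist_commute)
  qed
  moreover have "0 < L * \<kappa> + 1"
    using L \<kappa> by (simp add: add_nonneg_pos)
  ultimately show ?thesis
    unfolding G_def P_def by blast
qed

end
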